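(* Let $G$ be a finite EPPO-group. Then $\Gamma_{NCC}(G)$ is claw-free.
   Context: All groups are finite. A finite group is an EPPO-group if every non-identity element has prime power order. For a finite group $G$, the nilpotent conjugacy class graph $\Gamma_{NCC}(G)$ is the simple graph whose vertices are the non-central conjugacy classes of $G$ (the classes $x^G$ with $x\notin Z(G)$), two distinct vertices $x^G$ and $y^G$ being adjacent if and only if there exist $a\in x^G$ and $b\in y^G$ such that $\langle a,b\rangle$ is nilpotent. A graph is claw-free if it has no induced subgraph isomorphic to the complete bipartite graph $K_{1,3}$. *)

theory Defs
  imports
    "HOL-Algebra.Algebra"
    "HOL-Number_Theory.Prime_Powers"
    "Graph_Theory.Graph_Theory"
begin

definition EPPO :: "('a, 'b) monoid_scheme \<Rightarrow> bool" where
  "EPPO G \<longleftrightarrow> (\<forall>x \<in> carrier G. x \<noteq> \<one>\<^bsub>G\<^esub> \<longrightarrow> primepow (group.ord G x))"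

definition center :: "('a, 'b) monoid_scheme \<Rightarrow> 'a set" where
  "center G = {z \<in> carrier G. \<forall>g \<in> carrier G. z \<otimes>\<^bsub>G\<^esub> g = g \<otimes>\<^bsub>G\<^esub> z}"

(* The action is the one of the library theorem action_by_conjugation. *)
definition conj_class :: "('a, 'b) monoid_scheme \<Rightarrow> 'a \<Rightarrow> 'a set" where
  "conj_class G x = Group_Action.orbit G (\<lambda>g. \<lambda>h \<in> carrier G. g \<otimes>\<^bsub>G\<^esub> h \<otimes>\<^bsub>G\<^esub> inv\<^bsub>G\<^esub> g) x"

primrec lower_central :: "('a, 'b) monoid_scheme \<Rightarrow> nat \<Rightarrow> 'a set" where
  "lower_central G 0 = carrier G"
| "lower_central G (Suc n) = generate G
     (\<Union>x \<in> lower_central G n. \<Union>y \<in> carrier G.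
        {x \<otimes>\<^bsub>G\<^esub> y \<otimes>\<^bsub>G\<^esub> inv\<^bsub>G\<^esub> x \<otimes>\<^bsub>G\<^esub> inv\<^bsub>G\<^esub> y})"

definition nilpotent :: "('a, 'b) monoid_scheme \<Rightarrow> bool" where
  "nilpotent G \<longleftrightarrow> (\<exists>n. lower_central G n = {\<one>\<^bsub>G\<^esub>})"

definition ncc_verts :: "('a, 'b) monoid_scheme \<Rightarrow> 'a set set" where
  "ncc_verts G = conj_class G ` (carrier G - center G)"

(* An undirected edge is the pair of opposite arcs; graph_ncc_graph below shows
   that the result is a simple graph. *)
definition ncc_graph :: "('a, 'b) monoid_scheme \<Rightarrow> 'a set pair_pre_digraph" where
  "ncc_graph G =
     \<lparr> pverts = ncc_verts G,
       parcs = {(C, D). C \<in> ncc_verts G \<and> D \<in> ncc_verts G \<and> C \<noteq> D \<and>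
                  (\<exists>a \<in> C. \<exists>b \<in> D. nilpotent (G\<lparr>carrier := generate G {a, b}\<rparr>))} \<rparr>"

(* induced_subgraph includes well-formedness of the ambient graph, so this is
   meaningful only for graphs. *)
definition claw_free :: "('v, 'e) pre_digraph \<Rightarrow> bool" where
  "claw_free \<Gamma> \<longleftrightarrow> \<not> (\<exists>H. induced_subgraph H \<Gamma> \<and> K\<^bsub>1,3\<^esub> H)"

lemma graph_ncc_graph:
  assumes "finite (carrier G)"
  shows "graph (with_proj (ncc_graph G))"
proof -
  have fin: "finite (ncc_verts G)"
    using assms by (simp add: ncc_verts_def)
  have "parcs (ncc_graph G) \<subseteq> ncc_verts G \<times> ncc_verts G"
    by (auto simp: ncc_graph_def)
  then have fin': "finite (parcs (ncc_graph G))"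
    using fin by (meson finite_SigmaI finite_subset)
  have "pair_graph (ncc_graph G)"
  proof
    show "symmetric (with_proj (ncc_graph G))"
      unfolding symmetric_def
      by (rule symI) (simp add: ncc_graph_def, metis insert_commute)
  qed (use fin fin' in \<open>auto simp: ncc_graph_def\<close>)
  then interpret pair_graph "ncc_graph G" .
  show ?thesis by unfold_locales
qed

end

theory Submission
  imports Defs
begin

text \<open>
  In an EPPO-group \<open>G\<close> every element \<open>x \<noteq> \<one>\<close> belongs to exactly one prime, the one whose
  power is the order of \<open>x\<close>; conjugate elements belong to the same prime. Two distinct
  noncentral classes are adjacent if and only if they belong to the same prime
  (\<open>EPPO_nilpotent_conjugates_iff\<close>). Hence adjacency is transitive on distinct vertices, the graph
  is a disjoint union of complete graphs, and a claw is impossible because two leaves of a claw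
  have a common neighbour without being adjacent.

  If \<open>a, b \<noteq> \<one>\<close> generate a nilpotent group, that group has a central element \<open>z \<noteq> \<one>\<close>. Commuting
  nontrivial elements of an EPPO-group belong to the same prime, since otherwise the order of their
  product would be divisible by two primes (\<open>EPPO_commuting_same_prime\<close>). So \<open>a\<close> and \<open>b\<close> both
  belong to the prime of \<open>z\<close>.

  Conversely, if \<open>x\<close> and \<open>y\<close> have orders that are powers of one prime \<open>p\<close>, both have conjugates in
  a fixed Sylow \<open>p\<close>-subgroup, and these conjugates generate a \<open>p\<close>-group, which is nilpotent.

  Both facts about \<open>p\<close>-groups used in the second part, the conjugacy part of Sylow's theorem and
  nilpotency, rest on one counting argument: under an action of a \<open>p\<close>-group on a finite set the
  number of points that are moved is divisible by \<open>p\<close> (\<open>p_group_card_nonfixed\<close>).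
\<close>

section \<open>Fixed points and centers of p-groups\<close>

text \<open>
  The moved points are the union of the orbits with more than one element, and the size of such an
  orbit divides the order of the group, so it is a positive power of \<open>p\<close>.
\<close>

lemma (in group_action) p_group_card_nonfixed:
  assumes "Factorial_Ring.prime (p::nat)" and ordG: "order G = p ^ n" and fin: "finite E"
  shows "p dvd card {x \<in> E. \<exists>g \<in> carrier G. \<phi> g x \<noteq> x}"
proof -
  define M where "M = {Orb \<in> orbits G E \<phi>. card Orb \<noteq> 1}"
  have orbit_sub: "Group_Action.orbit G \<phi> x \<subseteq> E" if "x \<in> E" for x
    using that element_image by (auto simp: Group_Action.orbit_def)
  have nonfixed_iff: "card (Group_Action.orbit G \<phi> x) \<noteq> 1 \<longleftrightarrow> (\<exists>g \<in> carrier G. \<phi> g x \<noteq> x)" if x: "x \<in> E" for x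
  proof -
    have "card (Group_Action.orbit G \<phi> x) = 1 \<longleftrightarrow> Group_Action.orbit G \<phi> x = {x}"
      using orbit_refl[OF x] by (metis card_1_singletonE is_singletonI is_singleton_altdef singletonD)
    also have "\<dots> \<longleftrightarrow> (\<forall>g \<in> carrier G. \<phi> g x = x)"
      using orbit_refl[OF x] unfolding Group_Action.orbit_def by auto
    finally show ?thesis by blast
  qed
  have union: "{x \<in> E. \<exists>g \<in> carrier G. \<phi> g x \<noteq> x} = \<Union>M"
  proof
    show "{x \<in> E. \<exists>g \<in> carrier G. \<phi> g x \<noteq> x} \<subseteq> \<Union>M"
      using nonfixed_iff orbit_refl by (fastforce simp: M_def orbits_def)
    show "\<Union>M \<subseteq> {x \<in> E. \<exists>g \<in> carrier G. \<phi> g x \<noteq> x}"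
    proof
      fix y assume "y \<in> \<Union>M"
      then obtain x where x: "x \<in> E" "y \<in> Group_Action.orbit G \<phi> x"
          "card (Group_Action.orbit G \<phi> x) \<noteq> 1"
        by (auto simp: M_def orbits_def)
      have y: "y \<in> E" using x orbit_sub by blast
      \<comment> \<open>Being moved is a property of the whole orbit, since orbits that meet coincide.\<close>
      have "Group_Action.orbit G \<phi> x = Group_Action.orbit G \<phi> y"
        using disjoint_union[of "Group_Action.orbit G \<phi> x" "Group_Action.orbit G \<phi> y"] x y orbit_refl[OF y]
        by (auto simp: orbits_def)
      then show "y \<in> {x \<in> E. \<exists>g \<in> carrier G. \<phi> g x \<noteq> x}"
        using x y nonfixed_iff by simp
    qed
  qed
  have "p dvd card (\<Union>M)"
  proof (rule dvd_partition)
    show "finite (\<Union>M)" using fin unfolding union[symmetric] by simp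
    show "\<forall>Orb\<in>M. p dvd card Orb"
    proof
      fix Orb assume "Orb \<in> M"
      then obtain x where x: "x \<in> E" and Orb: "Orb = Group_Action.orbit G \<phi> x" and "card Orb \<noteq> 1"
        by (auto simp: M_def orbits_def)
      have "card Orb dvd p ^ n"
        using orbit_stabilizer_theorem[OF x] ordG Orb by (metis dvd_triv_left)
      then obtain i where "card Orb = p ^ i"
        using divides_primepow_nat[OF assms(1)] by blast
      with \<open>card Orb \<noteq> 1\<close> show "p dvd card Orb"
        by (cases i) auto
    qed
    show "\<forall>c1\<in>M. \<forall>c2\<in>M. c1 \<noteq> c2 \<longrightarrow> c1 \<inter> c2 = {}"
      using disjoint_union by (auto simp: M_def)
  qed
  then show ?thesis using union by simp
qed

lemma (in group) center_normal: "center G \<lhd> G"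
proof (rule normal_invI)
  show "subgroup (center G) G"
  proof (rule subgroupI)
    show "center G \<subseteq> carrier G" "center G \<noteq> {}"
      by (auto simp: center_def intro!: exI[of _ \<one>])
    show "inv a \<in> center G" if "a \<in> center G" for a
      using that by (auto simp: center_def) (metis inv_closed inv_inv inv_mult_group)
    show "a \<otimes> b \<in> center G" if "a \<in> center G" "b \<in> center G" for a b
    proof -
      have comm: "a \<otimes> b \<otimes> g = g \<otimes> (a \<otimes> b)" if g: "g \<in> carrier G" for g
      proof -
        have ab: "a \<in> carrier G" "b \<in> carrier G" "b \<otimes> g = g \<otimes> b" "a \<otimes> g = g \<otimes> a"
          using \<open>a \<in> center G\<close> \<open>b \<in> center G\<close> g by (auto simp: center_def)
        have "a \<otimes> b \<otimes> g = a \<otimes> g \<otimes> b" using ab g m_assoc by metis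
        then show ?thesis using ab g m_assoc by metis
      qed
      moreover have "a \<otimes> b \<in> carrier G" using that unfolding center_def by blast
      ultimately show ?thesis unfolding center_def by blast
    qed
  qed
  show "x \<otimes> h \<otimes> inv x \<in> center G" if "x \<in> carrier G" "h \<in> center G" for x h
  proof -
    have "h \<in> carrier G" "x \<otimes> h = h \<otimes> x" using that by (auto simp: center_def)
    then have "x \<otimes> h \<otimes> inv x = h" using that inv_solve_right' by (metis m_closed)
    then show ?thesis using that by simp
  qed
qed

text \<open>
  The center is the set of fixed points of the conjugation action. If it were trivial, \<open>p\<close> would
  divide both the order of the group and the order minus one.
\<close>

lemma (in group) p_group_center_nontrivial:
  assumes p: "Factorial_Ring.prime (p::nat)" and ordG: "order G = p ^ n" and "order G \<noteq> 1"
  shows "center G \<noteq> {\<one>}"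
proof
  assume triv: "center G = {\<one>}"
  interpret conj: group_action G "carrier G" "\<lambda>g. \<lambda>h \<in> carrier G. g \<otimes> h \<otimes> inv g"
    by (rule action_by_conjugation)
  have fin: "finite (carrier G)"
    using p ordG by (simp add: order_gt_0_iff_finite[symmetric] prime_gt_0_nat)
  have comm_iff: "g \<otimes> h \<otimes> inv g = h \<longleftrightarrow> h \<otimes> g = g \<otimes> h"
    if "g \<in> carrier G" "h \<in> carrier G" for g h
    using that by (metis inv_solve_right m_closed)
  have "{x \<in> carrier G. \<exists>g \<in> carrier G. (\<lambda>h \<in> carrier G. g \<otimes> h \<otimes> inv g) x \<noteq> x}
        = carrier G - center G"
    by (auto simp: center_def comm_iff)
  then have "p dvd card (carrier G - center G)"
    using conj.p_group_card_nonfixed[OF p ordG fin] by simp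
  then have "p dvd order G - 1"
    using fin triv by (simp add: order_def card_Diff_subset)
  moreover have "p dvd order G"
    using assms by (cases n) auto
  moreover have "order G > 0" using p ordG by (simp add: prime_gt_0_nat)
  ultimately have "p dvd 1"
    using dvd_diffD1[of p "order G" 1] by simp
  then show False using p by simp
qed

section \<open>The lower central series and the center\<close>

lemma (in group) lower_central_subset: "lower_central G n \<subseteq> carrier G"
proof (induction n)
  case (Suc n)
  then show ?case
    unfolding lower_central.simps by (intro generate_incl) auto
qed simp

lemma (in group) one_in_lower_central: "\<one> \<in> lower_central G n"
  by (cases n) (auto intro: generate.one)

text \<open>
  The preimage in \<open>G\<close> of the center of \<open>G/H\<close>, written as the union of the central cosets, plays the
  part of the next term above \<open>H\<close> in an upper central series: taking commutators with \<open>G\<close> moves it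
  down into \<open>H\<close>.
\<close>

lemma (in normal) commutator_center_quotient:
  assumes "x \<in> \<Union>(center (G Mod H))" and y: "y \<in> carrier G"
  shows "x \<otimes> y \<otimes> inv x \<otimes> inv y \<in> H"
proof -
  interpret Q: group "G Mod H" by (rule factorgroup_is_group)
  have x: "x \<in> carrier G" and cen: "H #> x \<in> center (G Mod H)"
    using assms(1) factgroup_subgroup_union_char[OF normal_imp_subgroup[OF Q.center_normal]]
    by auto
  have "(H #> x) <#> (H #> y) = (H #> y) <#> (H #> x)"
    using cen y by (auto simp: center_def carrier_FactGroup)
  then have "H #> (x \<otimes> y) = H #> (y \<otimes> x)"
    using x y by (simp add: rcos_sum)
  then have "(x \<otimes> y) \<otimes> inv (y \<otimes> x) \<in> H"
    using x y by (metis coset_join1 coset_mult_inv2 inv_closed is_subgroup m_closed subset)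
  then show ?thesis using x y by (simp add: inv_mult_group m_assoc)
qed

text \<open>
  Downward induction on the size of \<open>N\<close>, starting from \<open>N = G\<close>. For \<open>N \<noteq> G\<close> the quotient \<open>G/N\<close> is a
  nontrivial \<open>p\<close>-group, so the preimage \<open>K\<close> of its center is strictly larger than \<open>N\<close>. Once the
  lower central series has entered \<open>K\<close>, one more step takes it into \<open>N\<close>. Quantifying over the
  normal subgroups of the fixed group \<open>G\<close> replaces the customary induction on the group order
  through \<open>G/Z(G)\<close>, which would change the type of the elements at each step.
\<close>

lemma (in group) p_group_lower_central_le_normal:
  assumes p: "Factorial_Ring.prime (p::nat)" and ordG: "order G = p ^ n" and "N \<lhd> G"
  shows "\<exists>k. lower_central G k \<subseteq> N"
  using \<open>N \<lhd> G\<close>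
proof (induction "order G - card N" arbitrary: N rule: less_induct)
  case less
  interpret N: normal N G by (rule less.prems)
  interpret Q: group "G Mod N" by (rule N.factorgroup_is_group)
  have fin: "finite (carrier G)"
    using p ordG by (simp add: order_gt_0_iff_finite[symmetric] prime_gt_0_nat)
  show ?case
  proof (cases "N = carrier G")
    case True
    then have "lower_central G 0 \<subseteq> N" by simp
    then show ?thesis ..
  next
    case False
    define K where "K = \<Union>(center (G Mod N))"
    have K: "K \<lhd> G"
      unfolding K_def by (rule N.factgroup_subgroup_union_normal[OF Q.center_normal])
    have K_char: "K = {x \<in> carrier G. N #> x \<in> center (G Mod N)}"
      unfolding K_def
      by (rule N.factgroup_subgroup_union_char[OF normal_imp_subgroup[OF Q.center_normal]])
    have "order (G Mod N) dvd p ^ n"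
      using lagrange[OF N.is_subgroup] ordG
      by (metis FactGroup_def dvd_triv_left order_def partial_object.select_convs(1))
    then obtain m where m: "order (G Mod N) = p ^ m"
      using divides_primepow_nat[OF p] by blast
    have "order (G Mod N) \<noteq> 1"
      using False N.fact_group_trivial_iff[OF fin]
      by (metis Q.order_one_triv_iff)
    then have nontriv: "center (G Mod N) \<noteq> {\<one>\<^bsub>G Mod N\<^esub>}"
      by (rule Q.p_group_center_nontrivial[OF p m])
    have one_center: "N \<in> center (G Mod N)"
      using subgroup.one_closed[OF normal_imp_subgroup[OF Q.center_normal]] by simp
    have "N \<subseteq> K" using one_center unfolding K_def by blast
    moreover have "N \<noteq> K"
    proof
      assume "N = K"
      have "C = N" if "C \<in> center (G Mod N)" for C
      proof -
        have "C \<in> carrier (G Mod N)" using that unfolding center_def by blast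
        then obtain x where x: "x \<in> carrier G" "C = N #> x"
          unfolding carrier_FactGroup by blast
        then have "x \<in> N" using that K_char \<open>N = K\<close> by blast
        then show ?thesis using x coset_join2 N.is_subgroup by blast
      qed
      then show False using nontriv one_center by auto
    qed
    ultimately have "card N < card K"
      using fin K_char by (intro psubset_card_mono) (auto intro: finite_subset[of _ "carrier G"])
    moreover have "card K \<le> order G"
      using fin K_char by (auto simp: order_def intro: card_mono)
    ultimately obtain k where k: "lower_central G k \<subseteq> K"
      using less.hyps[OF _ K] by (metis diff_less_mono2 less_le_trans)
    have "lower_central G (Suc k) \<subseteq> N"
      unfolding lower_central.simps
      using k N.commutator_center_quotient N.is_subgroup
      by (intro generate_subgroup_incl) (auto simp: K_def)
    then show ?thesis ..
  qed
qed

lemma (in group) p_group_nilpotent: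
  assumes "Factorial_Ring.prime (p::nat)" and "order G = p ^ n"
  shows "nilpotent G"
  using p_group_lower_central_le_normal[OF assms one_is_normal] one_in_lower_central
  unfolding nilpotent_def by blast

text \<open>
  The last nontrivial term of the lower central series is central.
\<close>

lemma (in group) nilpotent_center_nontrivial:
  assumes "nilpotent G" and "carrier G \<noteq> {\<one>}"
  shows "center G \<noteq> {\<one>}"
proof -
  define n where "n = (LEAST n. lower_central G n = {\<one>})"
  have n: "lower_central G n = {\<one>}"
    using assms(1) unfolding nilpotent_def n_def by (rule LeastI_ex)
  then have "n \<noteq> 0" using assms(2) by (metis lower_central.simps(1))
  then obtain m where m: "n = Suc m" using not0_implies_Suc by blast
  then have "lower_central G m \<noteq> {\<one>}"
    using not_less_Least[of m "\<lambda>n. lower_central G n = {\<one>}"] unfolding n_def[symmetric] by simp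
  then obtain x where x: "x \<in> lower_central G m" "x \<noteq> \<one>"
    using one_in_lower_central by blast
  have xG: "x \<in> carrier G" using x lower_central_subset by blast
  have "x \<otimes> y = y \<otimes> x" if y: "y \<in> carrier G" for y
  proof -
    have "x \<otimes> y \<otimes> inv x \<otimes> inv y \<in> lower_central G n"
      unfolding m lower_central.simps using x y by (intro generate.incl) blast
    then have "x \<otimes> y \<otimes> inv x \<otimes> inv y = \<one>" using n by simp
    then show ?thesis
      using xG y by (metis inv_closed inv_equality inv_inv inv_solve_right m_closed)
  qed
  then show ?thesis using x xG by (auto simp: center_def)
qed

section \<open>Conjugating p-subgroups into a Sylow subgroup\<close>

text \<open>
  The inverse turns right multiplication, which reverses products, into a left action.
\<close>

lemma (in group) rcosets_action:
  assumes P: "subgroup P G"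
  shows "group_action G (rcosets P) (\<lambda>g. \<lambda>C \<in> rcosets P. C #> inv g)"
proof -
  let ?\<phi> = "\<lambda>g. \<lambda>C \<in> rcosets P. C #> inv g"
  have sub: "C \<subseteq> carrier G" if "C \<in> rcosets P" for C
    using that rcosets_part_G[OF P] by blast
  have closed: "C #> g \<in> rcosets P" if "C \<in> rcosets P" "g \<in> carrier G" for C g
    using that subgroup.subset[OF P] by (auto simp: RCOSETS_def coset_mult_assoc)
  have comp: "?\<phi> (g \<otimes> h) C = ?\<phi> g (?\<phi> h C)"
    if "g \<in> carrier G" "h \<in> carrier G" "C \<in> rcosets P" for g h C
    using that by (simp add: closed sub inv_mult_group coset_mult_assoc)
  have Bij: "?\<phi> g \<in> Bij (rcosets P)" if g: "g \<in> carrier G" for g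
  proof -
    have "bij_betw (?\<phi> g) (rcosets P) (rcosets P)"
      by (rule bij_betw_byWitness[where f' = "\<lambda>C. C #> g"])
         (auto simp: g closed sub coset_mult_assoc)
    then show ?thesis by (simp add: Bij_def)
  qed
  have "?\<phi> \<in> hom G (BijGroup (rcosets P))"
  proof (rule homI)
    show "?\<phi> g \<in> carrier (BijGroup (rcosets P))" if "g \<in> carrier G" for g
      using Bij[OF that] by (simp add: BijGroup_def)
    show "?\<phi> (g \<otimes> h) = ?\<phi> g \<otimes>\<^bsub>BijGroup (rcosets P)\<^esub> ?\<phi> h"
      if g: "g \<in> carrier G" and h: "h \<in> carrier G" for g h
    proof -
      have "?\<phi> (g \<otimes> h) = compose (rcosets P) (?\<phi> g) (?\<phi> h)"
        using comp[OF g h] by (intro ext) (simp add: compose_def)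
      then show ?thesis
        using Bij[OF g] Bij[OF h] by (simp add: BijGroup_def)
    qed
  qed
  then show ?thesis
    by (simp add: group_action_def group_hom_def group_hom_axioms_def group_BijGroup group_axioms)
qed

text \<open>
  \<open>Q\<close> acts on the cosets of \<open>P\<close>, whose number is prime to \<open>p\<close>, so some coset \<open>P g\<close> is fixed. Then
  \<open>P g q = P g\<close> for all \<open>q \<in> Q\<close>, which says that \<open>g q g\<^sup>-\<^sup>1\<close> lies in \<open>P\<close>.
\<close>

lemma (in group) p_subgroup_conjugate_into_Sylow:
  assumes p: "Factorial_Ring.prime (p::nat)" and fin: "finite (carrier G)"
    and P: "subgroup P G" and index: "\<not> p dvd card (rcosets P)"
    and Q: "subgroup Q G" and cardQ: "card Q = p ^ n"
  shows "\<exists>g \<in> carrier G. \<forall>q \<in> Q. g \<otimes> q \<otimes> inv g \<in> P"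
proof -
  let ?\<phi> = "\<lambda>g. \<lambda>C \<in> rcosets P. C #> inv g"
  interpret act: group_action "G\<lparr>carrier := Q\<rparr>" "rcosets P" ?\<phi>
    by (rule group_action.induced_action[OF rcosets_action[OF P] Q])
  have finR: "finite (rcosets P)"
    using fin by (simp add: RCOSETS_def)
  have "p dvd card {C \<in> rcosets P. \<exists>q \<in> Q. ?\<phi> q C \<noteq> C}"
    using act.p_group_card_nonfixed[OF p _ finR] cardQ by (simp add: order_def)
  then have "{C \<in> rcosets P. \<exists>q \<in> Q. ?\<phi> q C \<noteq> C} \<noteq> rcosets P"
    using index by metis
  then obtain C where C: "C \<in> rcosets P" and "\<forall>q \<in> Q. ?\<phi> q C = C"
    by blast
  then have fixed: "C #> inv q = C" if "q \<in> Q" for q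
    using that by simp
  obtain g where g: "g \<in> carrier G" "C = P #> g"
    using C by (auto simp: RCOSETS_def)
  have "g \<otimes> q \<otimes> inv g \<in> P" if q: "q \<in> Q" for q
  proof -
    have qG: "q \<in> carrier G" using q subgroup.subset[OF Q] by blast
    have "C #> q = C"
      using fixed[OF subgroup.m_inv_closed[OF Q q]] qG by simp
    then have "P #> (g \<otimes> q) = P #> g"
      using g qG subgroup.subset[OF P] by (simp add: coset_mult_assoc)
    then show ?thesis
      using g qG P by (metis coset_join1 coset_mult_inv2 inv_closed m_closed subgroup.subset)
  qed
  then show ?thesis using g by blast
qed

section \<open>Nilpotent two-generator subgroups of EPPO-groups\<close>

lemma (in group) mem_conj_class_iff:
  assumes "x \<in> carrier G"
  shows "a \<in> conj_class G x \<longleftrightarrow> (\<exists>g \<in> carrier G. a = g \<otimes> x \<otimes> inv g)"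
  using assms by (auto simp: conj_class_def Group_Action.orbit_def)

lemma (in group) ord_conj:
  assumes "x \<in> carrier G" "g \<in> carrier G"
  shows "ord (g \<otimes> x \<otimes> inv g) = ord x"
proof -
  have pow: "(g \<otimes> x \<otimes> inv g) [^] k = g \<otimes> x [^] k \<otimes> inv g" for k :: nat
  proof (induction k)
    case (Suc k)
    have "inv g \<otimes> (g \<otimes> (x \<otimes> inv g)) = x \<otimes> inv g"
      using assms by (simp add: m_assoc[symmetric])
    then have "g \<otimes> x [^] k \<otimes> inv g \<otimes> (g \<otimes> x \<otimes> inv g) = g \<otimes> x [^] Suc k \<otimes> inv g"
      using assms by (simp add: m_assoc)
    then show ?case using Suc by simp
  qed (use assms in simp)
  have "(g \<otimes> x \<otimes> inv g) [^] k = \<one> \<longleftrightarrow> x [^] k = \<one>" for k :: nat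
    unfolding pow using assms
    by (simp add: inv_solve_right')
  then show ?thesis
    using assms by (intro ord_unique[THEN iffD2]) (auto simp: pow_eq_id)
qed

text \<open>
  If the primes differed, \<open>x\<close> and \<open>z\<close> would have coprime orders. Both orders then divide the order of
  the product \<open>x z\<close>, which therefore has two prime divisors and is not a prime power.
\<close>

lemma (in group) EPPO_commuting_same_prime:
  assumes E: "EPPO G" and x: "x \<in> carrier G" "x \<noteq> \<one>" and z: "z \<in> carrier G" "z \<noteq> \<one>"
    and comm: "x \<otimes> z = z \<otimes> x"
  shows "aprimedivisor (ord x) = aprimedivisor (ord z)"
proof (rule ccontr)
  define p q where "p = aprimedivisor (ord x)" and "q = aprimedivisor (ord z)"
  define N where "N = ord (x \<otimes> z)"
  assume "\<not> ?thesis"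
  then have "p \<noteq> q" by (simp add: p_def q_def)
  have pp: "primepow (ord x)" "primepow (ord z)" using E x z by (auto simp: EPPO_def)
  have p: "Factorial_Ring.prime p" "p dvd ord x" and q: "Factorial_Ring.prime q" "q dvd ord z"
    using aprimedivisor_nat pp unfolding p_def q_def by (metis not_primepow_Suc_0_nat)+
  have ordx: "ord x = p ^ multiplicity p (ord x)" and ordz: "ord z = q ^ multiplicity q (ord z)"
    using primepow_decompose pp unfolding p_def q_def by metis+
  have cop: "coprime (ord x) (ord z)"
    using primes_coprime[OF p(1) q(1) \<open>p \<noteq> q\<close>] ordx ordz
    by (metis coprime_power_left_iff coprime_power_right_iff)
  have xzN: "x [^] N \<otimes> z [^] N = \<one>"
    using pow_mult_distrib[OF comm] x z unfolding N_def by (metis m_closed pow_ord_eq_1)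
  \<comment> \<open>Raising this equation to the order of one factor removes that factor.\<close>
  have "x [^] (N * ord z) = \<one>" and "z [^] (N * ord x) = \<one>"
  proof -
    have "(x [^] N \<otimes> z [^] N) [^] ord z = x [^] (N * ord z) \<otimes> z [^] (N * ord z)"
      using x z comm by (metis m_closed nat_pow_pow pow_mult_distrib)
    moreover have "z [^] (N * ord z) = \<one>" using z by (simp add: pow_eq_id)
    ultimately show "x [^] (N * ord z) = \<one>" using xzN x by simp
    have "(x [^] N \<otimes> z [^] N) [^] ord x = x [^] (N * ord x) \<otimes> z [^] (N * ord x)"
      using x z comm by (metis m_closed nat_pow_pow pow_mult_distrib)
    moreover have "x [^] (N * ord x) = \<one>" using x by (simp add: pow_eq_id)
    ultimately show "z [^] (N * ord x) = \<one>" using xzN z by simp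
  qed
  then have dvd: "ord x dvd N" "ord z dvd N"
    using x z cop
    by (auto simp: pow_eq_id coprime_dvd_mult_left_iff coprime_commute)
  have "N \<noteq> 1"
    using dvd pp by auto
  then have "x \<otimes> z \<noteq> \<one>" unfolding N_def by auto
  then have "primepow N" using E x z unfolding N_def by (auto simp: EPPO_def)
  then obtain s k where "Factorial_Ring.prime s" "N = s ^ k" by (auto simp: primepow_def)
  then show False
    using p q dvd \<open>p \<noteq> q\<close> by (metis dvd_trans prime_dvd_power primes_dvd_imp_eq)
qed

text \<open>
  A nontrivial central element of the generated subgroup commutes with both \<open>a\<close> and \<open>b\<close>, so it links
  their primes although \<open>a\<close> and \<open>b\<close> are not known to commute.
\<close>

lemma (in group) EPPO_nilpotent_imp_same_prime:
  assumes E: "EPPO G" and a: "a \<in> carrier G" "a \<noteq> \<one>" and b: "b \<in> carrier G" "b \<noteq> \<one>"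
    and nil: "nilpotent (G\<lparr>carrier := generate G {a, b}\<rparr>)"
  shows "aprimedivisor (ord a) = aprimedivisor (ord b)"
proof -
  let ?H = "generate G {a, b}"
  have H: "subgroup ?H G" using a b by (intro generate_is_subgroup) auto
  interpret H: group "G\<lparr>carrier := ?H\<rparr>" by (rule subgroup_imp_group[OF H])
  have ab: "a \<in> ?H" "b \<in> ?H" by (auto intro: generate.incl)
  have "center (G\<lparr>carrier := ?H\<rparr>) \<noteq> {\<one>}"
    using H.nilpotent_center_nontrivial[OF nil] a ab by auto
  moreover have "\<one> \<in> center (G\<lparr>carrier := ?H\<rparr>)"
    using subgroup.one_closed[OF normal_imp_subgroup[OF H.center_normal]] by simp
  ultimately obtain z where "z \<in> center (G\<lparr>carrier := ?H\<rparr>)" "z \<noteq> \<one>" by blast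
  then have z: "z \<in> carrier G" "z \<noteq> \<one>" "a \<otimes> z = z \<otimes> a" "b \<otimes> z = z \<otimes> b"
    using ab subgroup.subset[OF H] by (auto simp: center_def)
  then show ?thesis
    using EPPO_commuting_same_prime[OF E a z(1,2)] EPPO_commuting_same_prime[OF E b z(1,2)] by simp
qed

text \<open>
  Both elements have conjugates in one Sylow \<open>p\<close>-subgroup, and any two elements of it generate a
  \<open>p\<close>-group.
\<close>

lemma (in group) p_elements_conjugate_nilpotent:
  assumes fin: "finite (carrier G)" and p: "Factorial_Ring.prime (p::nat)"
    and x: "x \<in> carrier G" "ord x = p ^ k" and y: "y \<in> carrier G" "ord y = p ^ l"
  shows "\<exists>a \<in> conj_class G x. \<exists>b \<in> conj_class G y. nilpotent (G\<lparr>carrier := generate G {a, b}\<rparr>)"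
proof -
  have pos: "order G > 0" using fin by (simp add: order_gt_0_iff_finite)
  obtain m where m: "order G = p ^ multiplicity p (order G) * m" "\<not> p dvd m"
    using multiplicity_decompose'[of "order G" p] pos p by (metis not_prime_unit less_irrefl)
  obtain P where P: "subgroup P G" "card P = p ^ multiplicity p (order G)"
    using sylow_thm[OF p group_axioms m(1) fin] by blast
  have "card (rcosets P) = m"
    using lagrange[OF P(1)] m(1) P(2) prime_gt_0_nat[OF p]
    by (metis mult.commute mult_right_cancel not_gr_zero power_eq_0_iff)
  then have index: "\<not> p dvd card (rcosets P)" using m by simp
  have into_P: "\<exists>a \<in> conj_class G u. a \<in> P" if u: "u \<in> carrier G" "ord u = p ^ j" for u j
  proof -
    have "subgroup (generate G {u}) G" "card (generate G {u}) = p ^ j"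
      using u generate_is_subgroup generate_pow_card by auto
    then obtain g where "g \<in> carrier G" "\<forall>q \<in> generate G {u}. g \<otimes> q \<otimes> inv g \<in> P"
      using p_subgroup_conjugate_into_Sylow[OF p fin P(1) index] by blast
    then show ?thesis
      using u by (metis generate.incl mem_conj_class_iff singletonI)
  qed
  obtain a b where a: "a \<in> conj_class G x" "a \<in> P" and b: "b \<in> conj_class G y" "b \<in> P"
    using into_P x y by metis
  let ?H = "generate G {a, b}"
  have sub: "?H \<subseteq> P" using a b P by (intro generate_subgroup_incl) auto
  have H: "subgroup ?H G"
    using a b subgroup.subset[OF P(1)] by (intro generate_is_subgroup) auto
  interpret P: group "G\<lparr>carrier := P\<rparr>" by (rule subgroup_imp_group[OF P(1)])
  interpret H: group "G\<lparr>carrier := ?H\<rparr>" by (rule subgroup_imp_group[OF H])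
  have "subgroup ?H (G\<lparr>carrier := P\<rparr>)"
    by (rule subgroup_incl[OF H P(1) sub])
  then have "card ?H dvd p ^ multiplicity p (order G)"
    using P.lagrange P(2) by (metis dvd_triv_right order_def partial_object.select_convs(1)
      partial_object.surjective partial_object.update_convs(1))
  then obtain i where "card ?H = p ^ i"
    using divides_primepow_nat[OF p] by blast
  then have "nilpotent (G\<lparr>carrier := ?H\<rparr>)"
    using H.p_group_nilpotent[OF p] by (simp add: order_def)
  then show ?thesis using a b by blast
qed

text \<open>
  For a prime power, \<open>aprimedivisor\<close> is the prime. So this turns adjacency in the graph into equality
  of an invariant of the classes.
\<close>

lemma (in group) EPPO_nilpotent_conjugates_iff:
  assumes fin: "finite (carrier G)" and E: "EPPO G"
    and x: "x \<in> carrier G" "x \<noteq> \<one>" and y: "y \<in> carrier G" "y \<noteq> \<one>"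
  shows "(\<exists>a \<in> conj_class G x. \<exists>b \<in> conj_class G y. nilpotent (G\<lparr>carrier := generate G {a, b}\<rparr>))
    \<longleftrightarrow> aprimedivisor (ord x) = aprimedivisor (ord y)" (is "?L \<longleftrightarrow> ?R")
proof
  have conj: "a \<in> carrier G \<and> a \<noteq> \<one> \<and> ord a = ord u"
    if a: "a \<in> conj_class G u" and u: "u \<in> carrier G" "u \<noteq> \<one>" for a u
  proof -
    have "a \<in> carrier G" "ord a = ord u"
      using a u by (auto simp: mem_conj_class_iff ord_conj)
    then show ?thesis using u by (metis ord_eq_1)
  qed
  assume ?L
  then show ?R
    using EPPO_nilpotent_imp_same_prime[OF E] conj[OF _ x] conj[OF _ y] by metis
next
  assume R: ?R
  have pp: "primepow (ord x)" "primepow (ord y)" using E x y by (auto simp: EPPO_def)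
  show ?L
  proof (rule p_elements_conjugate_nilpotent[OF fin _ x(1) _ y(1)])
    show "Factorial_Ring.prime (aprimedivisor (ord x))"
      using pp aprimedivisor_nat(1) by (metis not_primepow_Suc_0_nat)
    show "ord x = aprimedivisor (ord x) ^ multiplicity (aprimedivisor (ord x)) (ord x)"
      using primepow_decompose[OF pp(1)] by simp
    show "ord y = aprimedivisor (ord x) ^ multiplicity (aprimedivisor (ord y)) (ord y)"
      using primepow_decompose[OF pp(2)] R by simp
  qed
qed

lemma ncc_graph_adjacency_trans:
  assumes "group G" and "finite (carrier G)" and "EPPO G"
    and CD: "(C, D) \<in> parcs (ncc_graph G)" and DF: "(D, F) \<in> parcs (ncc_graph G)" and "C \<noteq> F"
  shows "(C, F) \<in> parcs (ncc_graph G)"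
proof -
  interpret group G by fact
  \<comment> \<open>The identity is central, so the representatives of vertices are nontrivial.\<close>
  have noncentral: "x \<in> carrier G \<and> x \<noteq> \<one>\<^bsub>G\<^esub>" if "x \<in> carrier G - center G" for x
    using that by (auto simp: center_def)
  obtain x y z where xyz: "x \<in> carrier G - center G" "y \<in> carrier G - center G" "z \<in> carrier G - center G"
    and C: "C = conj_class G x" and D: "D = conj_class G y" and F: "F = conj_class G z"
    using CD DF by (auto simp: ncc_graph_def ncc_verts_def)
  note iff = EPPO_nilpotent_conjugates_iff[OF assms(2,3)]
  have "aprimedivisor (ord x) = aprimedivisor (ord y)" "aprimedivisor (ord y) = aprimedivisor (ord z)"
    using CD DF iff noncentral xyz unfolding ncc_graph_def C D F by auto
  then have "\<exists>a \<in> C. \<exists>b \<in> F. nilpotent (G\<lparr>carrier := generate G {a, b}\<rparr>)"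
    using iff noncentral xyz unfolding C F by auto
  then show ?thesis
    using CD DF \<open>C \<noteq> F\<close> by (simp add: ncc_graph_def)
qed

text \<open>
  Two distinct leaves of a claw are both joined to its center, so transitivity would make them
  adjacent, and an induced subgraph would contain this edge.
\<close>

lemma claw_free_if_trans:
  assumes trans: "\<And>u v w. (u, v) \<in> parcs \<Gamma> \<Longrightarrow> (v, w) \<in> parcs \<Gamma> \<Longrightarrow> u \<noteq> w \<Longrightarrow> (u, w) \<in> parcs \<Gamma>"
  shows "claw_free (with_proj \<Gamma>)"
  unfolding claw_free_def
proof (intro notI, elim exE conjE)
  fix H assume ind: "induced_subgraph H (with_proj \<Gamma>)" and K: "K\<^bsub>1,3\<^esub> H"
  obtain U V where verts: "verts H = U \<union> V" and disj: "U \<inter> V = {}"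
    and card: "card U = 1" "card V = 3" and ends: "arcs_ends H = U \<times> V \<union> V \<times> U"
    using K by (auto simp: complete_bipartite_digraph_def)
  have "compatible (with_proj \<Gamma>) H"
    using ind by (auto simp: induced_subgraph_def subgraph_def)
  then have "tail H = fst" "head H = snd" by (auto simp: compatible_def)
  then have "arcs_ends H = arcs H" by (auto simp: arcs_ends_def arc_to_ends_def)
  then have arcs: "arcs H = U \<times> V \<union> V \<times> U" using ends by simp
  have ind_arcs: "arcs H = {e \<in> parcs \<Gamma>. fst e \<in> verts H \<and> snd e \<in> verts H}"
    using ind by (simp add: induced_subgraph_def)
  obtain c where c: "c \<in> U" using card by (metis card_1_singletonE singletonI)
  obtain v w where vw: "v \<in> V" "w \<in> V" "v \<noteq> w"
    using card(2) by (auto simp: numeral_3_eq_3 card_Suc_eq)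
  have "(v, c) \<in> arcs H" "(c, w) \<in> arcs H" using c vw arcs by auto
  then have "(v, w) \<in> parcs \<Gamma>" using ind_arcs trans vw(3) by blast
  then have "(v, w) \<in> arcs H" using ind_arcs verts vw by auto
  then show False using arcs vw disj by auto
qed

theorem theorem2p12:
  fixes G :: "('a, 'b) monoid_scheme"
  assumes "group G" and "finite (carrier G)" and "EPPO G"
  shows "claw_free (with_proj (ncc_graph G))"
  by (rule claw_free_if_trans) (rule ncc_graph_adjacency_trans[OF assms])

end
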